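(* Let $a,b>0$ and $N\in\mathbb{N}$ (with $N\ge 1$). If $0\leq\nu\leq \frac{1}{2}$, then $$\nu a+(1-\nu) b+S_N(2\nu;\sqrt{ab},a)\leq a^{\nu}b^{1-\nu}+(1-\nu)(\sqrt{a}-\sqrt{b})^2.$$ If $\frac{1}{2}\leq \nu\leq 1$, then $$\nu a+(1-\nu) b+S_N(2-2\nu;\sqrt{ab},b)\leq a^{\nu}b^{1-\nu}+\nu(\sqrt{a}-\sqrt{b})^2.$$
   Context: $[x]$ denotes the greatest integer $\le x$. For $\nu\in[0,1]$ and $j\geq 1$ put $k_j(\nu)=[2^{j-1}\nu]$, $r_j(\nu)=[2^{j}\nu]$ and $s_j(\nu)=(-1)^{r_j(\nu)}2^{j-1}\nu+(-1)^{r_j(\nu)+1}\left[\frac{r_j(\nu)+1}{2}\right]$. For $a,b>0$, $\nu\in[0,1]$ and $N\ge 1$ define $$S_N(\nu;a,b)=\sum_{j=1}^{N}s_j(\nu)\left(\sqrt[2^j]{b^{2^{j-1}-k_j(\nu)}a^{k_j(\nu)}}-\sqrt[2^{j}]{a^{k_j(\nu)+1}b^{2^{j-1}-k_j(\nu)-1}}\right)^2 .$$ *)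

theory Defs
  imports Complex_Main
begin

text \<open>
  All four definitions are meant for \<open>j \<ge> 1\<close> and \<open>\<nu> \<in> [0,1]\<close>. The values of \<open>kk\<close> and \<open>rr\<close> are
  integers rather than naturals because the exponent \<open>2\<^sup>j\<^sup>-\<^sup>1 - k\<^sub>j(\<nu>) - 1\<close> in \<open>SS\<close> equals \<open>-1\<close>
  at \<open>\<nu> = 1\<close> and must not be truncated.
\<close>

definition kk :: "nat \<Rightarrow> real \<Rightarrow> int" where
  "kk j \<nu> = \<lfloor>2 ^ (j - 1) * \<nu>\<rfloor>"

definition rr :: "nat \<Rightarrow> real \<Rightarrow> int" where
  "rr j \<nu> = \<lfloor>2 ^ j * \<nu>\<rfloor>"

definition ss :: "nat \<Rightarrow> real \<Rightarrow> real" where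
  "ss j \<nu> = (-1) powi (rr j \<nu>) * 2 ^ (j - 1) * \<nu>
     + (-1) powi (rr j \<nu> + 1) * of_int \<lfloor>(of_int (rr j \<nu>) + 1) / (2::real)\<rfloor>"

definition SS :: "nat \<Rightarrow> real \<Rightarrow> real \<Rightarrow> real \<Rightarrow> real" where
  "SS N \<nu> a b = (\<Sum>j=1..N. ss j \<nu> *
     (root (2 ^ j) (b powi (2 ^ (j - 1) - kk j \<nu>) * a powi (kk j \<nu>))
      - root (2 ^ j) (a powi (kk j \<nu> + 1) * b powi (2 ^ (j - 1) - kk j \<nu> - 1)))\<^sup>2)"

end

theory Submission
  imports Defs "HOL-Analysis.Convex"
begin

text \<open>
  Along \<open>x \<mapsto> a\<^sup>x b\<^sup>1\<^sup>-\<^sup>x\<close> the sum \<open>SS N \<nu> a b\<close> telescopes: its \<open>j\<close>-th summand is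
  the difference at \<open>\<nu>\<close> of the piecewise linear interpolants of that function on the dyadic grids
  of mesh \<open>2\<^sup>1\<^sup>-\<^sup>j\<close> and \<open>2\<^sup>-\<^sup>j\<close>. Since the function is convex it lies below all its
  interpolants, which gives the refined Young inequality
  \<open>a\<^sup>\<nu> b\<^sup>1\<^sup>-\<^sup>\<nu> + SS N \<nu> a b \<le> \<nu> a + (1 - \<nu>) b\<close>. Applied with \<open>2\<nu>\<close>, \<open>\<surd>(ab)\<close> and \<open>a\<close>,
  it reduces the theorem to \<open>2\<surd>(ab) \<le> a\<^sup>\<nu> b\<^sup>1\<^sup>-\<^sup>\<nu> + a\<^sup>1\<^sup>-\<^sup>\<nu> b\<^sup>\<nu>\<close>.
\<close>

definition geo :: "real \<Rightarrow> real \<Rightarrow> real \<Rightarrow> real" where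
  "geo a b x = a powr x * b powr (1 - x)"

text \<open>The right node is always \<open>floor + 1\<close>, even at a grid point, where its
  weight is zero. At \<open>x = 1\<close> it lies outside the unit interval.\<close>

definition dyadic_interp :: "(real \<Rightarrow> real) \<Rightarrow> nat \<Rightarrow> real \<Rightarrow> real" where
  "dyadic_interp f m x = (1 - frac (2 ^ m * x)) * f (of_int \<lfloor>2 ^ m * x\<rfloor> / 2 ^ m)
     + frac (2 ^ m * x) * f ((of_int \<lfloor>2 ^ m * x\<rfloor> + 1) / 2 ^ m)"

lemma geo_nonneg: "0 \<le> geo a b x"
  by (simp add: geo_def)

lemma geo_swap: "geo b a (1 - x) = geo a b x"
  by (simp add: geo_def)

text \<open>The logarithm of \<open>geo a b\<close> is affine. Hence midpoints go to geometric
  means, and weighted AM-GM yields convexity.\<close>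

lemma geo_combine:
  assumes "a > 0" "b > 0"
  shows "geo a b ((1 - t) * x + t * y) = geo a b x powr (1 - t) * geo a b y powr t"
  using assms by (simp add: geo_def powr_def exp_add [symmetric] ln_mult algebra_simps)

lemma geo_midpoint:
  assumes "a > 0" "b > 0"
  shows "geo a b ((x + y) / 2) = sqrt (geo a b x) * sqrt (geo a b y)"
  using geo_combine[OF assms, of "1/2" x y] geo_nonneg[of a b x] geo_nonneg[of a b y]
  by (simp add: powr_half_sqrt add_divide_distrib)

lemma geo_convex:
  assumes "a > 0" "b > 0" "0 \<le> t" "t \<le> 1"
  shows "geo a b ((1 - t) * x + t * y) \<le> (1 - t) * geo a b x + t * geo a b y"
  using assms geo_combine[of a b t x y] Youngs_inequality_0[of "1 - t" t "geo a b x" "geo a b y"]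
  by (simp add: geo_def)

lemma geo_le_dyadic_interp:
  assumes "a > 0" "b > 0"
  shows "geo a b x \<le> dyadic_interp (geo a b) m x"
proof -
  let ?t = "frac (2 ^ m * x)" and ?k = "of_int \<lfloor>2 ^ m * x\<rfloor> :: real"
  have "(1 - ?t) * (?k / 2 ^ m) + ?t * ((?k + 1) / 2 ^ m) = (?k + ?t) / 2 ^ m"
    by (simp add: field_simps)
  also have "\<dots> = x"
    by (simp add: frac_def)
  finally show ?thesis
    using geo_convex[OF assms, of ?t "?k / 2 ^ m" "(?k + 1) / 2 ^ m"]
    by (simp add: dyadic_interp_def frac_ge_0 frac_lt_1 less_imp_le)
qed

lemma dyadic_interp_0:
  assumes "a > 0" "b > 0" "0 \<le> x" "x \<le> 1"
  shows "dyadic_interp (geo a b) 0 x = x * a + (1 - x) * b"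
proof (cases "x = 1")
  case True
  then show ?thesis using assms by (simp add: dyadic_interp_def geo_def)
next
  case False
  then have "\<lfloor>x\<rfloor> = 0" using assms by (simp add: floor_eq_iff)
  then show ?thesis using assms by (simp add: dyadic_interp_def geo_def frac_def)
qed

text \<open>Arbitrary integers \<open>k\<close> are allowed because the right node at
  \<open>x = 1\<close> has index \<open>2 ^ m + 1\<close>.\<close>

lemma root_powi_eq_sqrt_geo:
  fixes k :: int
  assumes "a > 0" "b > 0"
  shows "root (2 ^ Suc m) (a powi k * b powi (2 ^ m - k)) = sqrt (geo a b (of_int k / 2 ^ m))"
proof -
  have "root (2 ^ Suc m) (a powi k * b powi (2 ^ m - k))
      = (a powr of_int k * b powr of_int (2 ^ m - k)) powr (1 / 2 ^ Suc m)"
    using assms powr_real_of_int'[of a k] powr_real_of_int'[of b "2 ^ m - k"]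
    by (simp add: root_powr_inverse inverse_eq_divide del: of_int_diff)
  also have "\<dots> = geo a b (of_int k / 2 ^ m) powr (1 / 2)"
    using assms by (simp add: geo_def powr_mult powr_powr field_simps)
  finally show ?thesis
    by (simp add: powr_half_sqrt geo_nonneg)
qed

text \<open>Halving the mesh adds only the midpoint of the cell containing \<open>x\<close>, so the
  interpolants differ by a hat function, namely \<open>ss\<close>, times
  \<open>A + B - 2 * M\<close>. Since \<open>M\<close> is the geometric mean of \<open>A\<close> and
  \<open>B\<close>, that factor is the square of \<open>sqrt A - sqrt B\<close>.\<close>

lemma SS_summand_eq:
  assumes "a > 0" "b > 0"
  shows "ss (Suc m) x *
     (root (2 ^ Suc m) (b powi (2 ^ m - kk (Suc m) x) * a powi (kk (Suc m) x))
      - root (2 ^ Suc m) (a powi (kk (Suc m) x + 1) * b powi (2 ^ m - kk (Suc m) x - 1)))\<^sup>2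
     = dyadic_interp (geo a b) m x - dyadic_interp (geo a b) (Suc m) x"
proof -
  define k where "k = \<lfloor>2 ^ m * x\<rfloor>"
  define t where "t = frac (2 ^ m * x)"
  define A where "A = geo a b (of_int k / 2 ^ m)"
  define B where "B = geo a b ((of_int k + 1) / 2 ^ m)"
  define M where "M = geo a b ((2 * of_int k + 1) / 2 ^ Suc m)"
  have x: "2 ^ m * x = of_int k + t"
    by (simp add: k_def t_def frac_def)
  have t: "0 \<le> t" "t < 1"
    by (simp_all add: t_def frac_ge_0 frac_lt_1)
  have kk: "kk (Suc m) x = k"
    by (simp add: kk_def k_def)
  have rr: "rr (Suc m) x = \<lfloor>2 ^ Suc m * x\<rfloor>"
    by (simp add: rr_def)
  have x2: "2 ^ Suc m * x = 2 * of_int k + 2 * t"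
    using x by simp
  have M: "M = sqrt A * sqrt B"
    using geo_midpoint[OF assms, of "of_int k / 2 ^ m" "(of_int k + 1) / 2 ^ m"]
    by (simp add: A_def B_def M_def add_divide_distrib mult.commute)
  have roots: "(root (2 ^ Suc m) (b powi (2 ^ m - k) * a powi k)
      - root (2 ^ Suc m) (a powi (k + 1) * b powi (2 ^ m - k - 1)))\<^sup>2 = A + B - 2 * M"
    using root_powi_eq_sqrt_geo[OF assms, of m k] root_powi_eq_sqrt_geo[OF assms, of m "k + 1"]
    by (simp add: power2_diff M A_def B_def geo_nonneg mult.commute diff_diff_eq del: power_Suc)
  have L: "dyadic_interp (geo a b) m x = (1 - t) * A + t * B"
    by (simp add: dyadic_interp_def A_def B_def k_def t_def)
  show ?thesis
  \<comment> \<open>The half of the cell containing \<open>x\<close> fixes the parity of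
    \<open>rr\<close> and thus the signs in \<open>ss\<close>, which is the distance from
    \<open>2 ^ m * x\<close> to the nearest integer: \<open>t\<close> or
    \<open>1 - t\<close>.\<close>
  proof (cases "t < 1 / 2")
    case True
    have fl: "\<lfloor>2 ^ Suc m * x\<rfloor> = 2 * k"
      unfolding x2 floor_eq_iff using t True by simp
    have "frac (2 ^ Suc m * x) = 2 * t"
      unfolding frac_def fl by (simp add: x2 del: power_Suc)
    then have D: "dyadic_interp (geo a b) (Suc m) x = (1 - 2 * t) * A + 2 * t * M"
      unfolding dyadic_interp_def fl by (simp add: A_def M_def)
    have "\<lfloor>(of_int (2 * k) + 1) / (2::real)\<rfloor> = k"
      by (simp add: floor_eq_iff)
    then have S: "ss (Suc m) x = t"
      using x unfolding ss_def rr fl by (simp add: power_int_add)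
    show ?thesis
      unfolding kk roots L D S by (simp add: algebra_simps)
  next
    case False
    have fl: "\<lfloor>2 ^ Suc m * x\<rfloor> = 2 * k + 1"
      unfolding x2 floor_eq_iff using t False by simp
    have "frac (2 ^ Suc m * x) = 2 * t - 1"
      unfolding frac_def fl by (simp add: x2 del: power_Suc)
    moreover have "(of_int (2 * k + 1) + 1) / 2 ^ Suc m = (of_int k + 1) / (2 ^ m :: real)"
      by (simp add: field_simps)
    ultimately have D: "dyadic_interp (geo a b) (Suc m) x = (2 - 2 * t) * M + (2 * t - 1) * B"
      unfolding dyadic_interp_def fl by (simp add: B_def M_def)
    have "\<lfloor>(of_int (2 * k + 1) + 1) / (2::real)\<rfloor> = k + 1"
      by (simp add: floor_eq_iff)
    then have S: "ss (Suc m) x = 1 - t"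
      using x unfolding ss_def rr fl by (simp add: power_int_add)
    show ?thesis
      unfolding kk roots L D S by (simp add: algebra_simps)
  qed
qed

lemma SS_eq_dyadic_interp:
  assumes "a > 0" "b > 0"
  shows "SS N x a b = dyadic_interp (geo a b) 0 x - dyadic_interp (geo a b) N x"
proof (induction N)
  case 0
  then show ?case by (simp add: SS_def)
next
  case (Suc N)
  have "SS (Suc N) x a b = SS N x a b
      + (dyadic_interp (geo a b) N x - dyadic_interp (geo a b) (Suc N) x)"
    unfolding SS_summand_eq[OF assms, symmetric] by (simp add: SS_def)
  with Suc show ?case by simp
qed

theorem refined_Young:
  assumes "a > 0" "b > 0" "0 \<le> x" "x \<le> 1"
  shows "geo a b x + SS N x a b \<le> x * a + (1 - x) * b"
  using geo_le_dyadic_interp[of a b x N] assms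
  by (simp add: SS_eq_dyadic_interp dyadic_interp_0)

lemma reversed_Young_left_half:
  assumes "a > 0" "b > 0" "0 \<le> x" "x \<le> 1 / 2"
  shows "x * a + (1 - x) * b + SS N (2 * x) (sqrt (a * b)) a
           \<le> geo a b x + (1 - x) * (sqrt a - sqrt b)\<^sup>2"
proof -
  have sq: "(sqrt a - sqrt b)\<^sup>2 = a + b - 2 * sqrt (a * b)"
    using assms by (simp add: power2_diff real_sqrt_mult)
  \<comment> \<open>The path from \<open>a\<close> at 0 to \<open>b\<close> at 1 has its midpoint at
    \<open>sqrt (a * b)\<close>; doubling the parameter covers its first half.\<close>
  have geo: "geo (sqrt (a * b)) a (2 * x) = geo b a x"
    using assms
    by (simp add: geo_def powr_def ln_mult ln_sqrt exp_add [symmetric] field_simps)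
  \<comment> \<open>AM-GM for two numbers with product \<open>a * b\<close>. This is exactly what
    remains, because \<open>x * a + (1 - x) * b\<close> plus the linear bound
    \<open>2 * x * sqrt (a * b) + (1 - 2 * x) * a\<close> equals
    \<open>(1 - x) * (sqrt a - sqrt b)\<^sup>2 + 2 * sqrt (a * b)\<close>.\<close>
  have "2 * sqrt (a * b) \<le> geo a b x + geo b a x"
  proof -
    have "geo a b x * geo b a x = a * b"
      using assms by (simp add: geo_def powr_def exp_add [symmetric] field_simps)
        (simp add: exp_add)
    then show ?thesis
      using arith_geo_mean_sqrt[OF geo_nonneg geo_nonneg, of a b x b a x] by simp
  qed
  with refined_Young[of "sqrt (a * b)" a "2 * x" N] assms show ?thesis
    unfolding sq geo by (simp add: algebra_simps)
qed

theorem theorem2p1: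
  fixes a b \<nu> :: real and N :: nat
  assumes "a > 0" and "b > 0" and "N \<ge> 1"
  shows "(0 \<le> \<nu> \<and> \<nu> \<le> 1 / 2 \<longrightarrow>
            \<nu> * a + (1 - \<nu>) * b + SS N (2 * \<nu>) (sqrt (a * b)) a
              \<le> a powr \<nu> * b powr (1 - \<nu>) + (1 - \<nu>) * (sqrt a - sqrt b)\<^sup>2)
       \<and> (1 / 2 \<le> \<nu> \<and> \<nu> \<le> 1 \<longrightarrow>
            \<nu> * a + (1 - \<nu>) * b + SS N (2 - 2 * \<nu>) (sqrt (a * b)) b
              \<le> a powr \<nu> * b powr (1 - \<nu>) + \<nu> * (sqrt a - sqrt b)\<^sup>2)"
  \<comment> \<open>The second half is the first after exchanging \<open>a\<close> with
    \<open>b\<close> and \<nu> with \<open>1 - \<nu>\<close>.\<close>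
  using reversed_Young_left_half[of a b \<nu> N] reversed_Young_left_half[of b a "1 - \<nu>" N] assms
  by (auto simp: geo_swap geo_def[symmetric] mult.commute[of b a] power2_commute[of "sqrt b"]
      algebra_simps)

end
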